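(* Let $K$ be a field, $n\le r$ integers, and $(A_1,A_2,A_3)$ a triple of matrices in $M_n(K)$ such that (i) $\operatorname{Im}[A_1,A_2]$, $\operatorname{Im}[A_1,A_3]$, $\operatorname{Im}[A_2,A_3]$ all have dimension $2(r-n)$, and (ii) $\operatorname{Im}[A_1,A_2]+\operatorname{Im}[A_1,A_3]$, $\operatorname{Im}[A_2,A_1]+\operatorname{Im}[A_2,A_3]$, $\operatorname{Im}[A_3,A_1]+\operatorname{Im}[A_3,A_2]$ all have dimension $3(r-n)$. If $(Z_1,Z_2,Z_3)$ and $(Z'_1,Z'_2,Z'_3)$ are two commuting extensions of size $r$ of $(A_1,A_2,A_3)$ such that $B_1=B'_1$, then $(Z_1,Z_2,Z_3)=(Z'_1,Z'_2,Z'_3)$.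
   Context: $[A,B]=AB-BA$, $\operatorname{Im}A$ is the column space. A tuple $(Z_1,\ldots,Z_p)$ of $r\times r$ matrices over $K$ is a commuting extension of size $r$ of $(A_1,\ldots,A_p)$ ($n\times n$) if the $Z_i$ pairwise commute and $Z_i=\begin{pmatrix} A_i & B_i\\ C_i & D_i\end{pmatrix}$ with $B_i\in M_{n,r-n}(K)$, $C_i\in M_{r-n,n}(K)$, $D_i\in M_{r-n}(K)$; the blocks of $Z'_i$ are denoted $A_i,B'_i,C'_i,D'_i$. *)

theory Defs
  imports "Jordan_Normal_Form.DL_Rank"
begin

definition commutator :: "'a::field mat \<Rightarrow> 'a mat \<Rightarrow> 'a mat" where
  "commutator A B = A * B - B * A"

definition column_space :: "'a::field mat \<Rightarrow> 'a vec set" where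
  "column_space A =
     LinearCombinations.module.span class_ring (module_vec TYPE('a) (dim_row A)) (set (cols A))"

definition subspace_plus :: "nat \<Rightarrow> 'a::field vec set \<Rightarrow> 'a vec set \<Rightarrow> 'a vec set" where
  "subspace_plus n U W = LinearCombinations.module.submodule_sum (module_vec TYPE('a) n) U W"

text \<open>Meaningful when \<open>W\<close> is a linear subspace of \<open>carrier_vec n\<close>.\<close>

definition subspace_dim :: "nat \<Rightarrow> 'a::field vec set \<Rightarrow> nat" where
  "subspace_dim n W =
     vectorspace.dim (class_ring :: 'a ring) ((module_vec TYPE('a) n)\<lparr>carrier := W\<rparr>)"

text \<open>Tuples of matrices are lists. The natural-number subtraction \<open>r - n\<close> is genuine, since the
  conditions on a nonempty tuple can only hold when \<open>n \<le> r\<close>.\<close>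

definition commuting_extension ::
    "nat \<Rightarrow> nat \<Rightarrow> 'a::field mat list \<Rightarrow> 'a mat list \<Rightarrow> bool" where
  "commuting_extension n r As Zs \<longleftrightarrow>
     length Zs = length As \<and>
     set As \<subseteq> carrier_mat n n \<and>
     set Zs \<subseteq> carrier_mat r r \<and>
     (\<forall>i < length Zs. \<forall>j < length Zs. Zs ! i * Zs ! j = Zs ! j * Zs ! i) \<and>
     (\<forall>i < length Zs. \<exists>B \<in> carrier_mat n (r - n). \<exists>C \<in> carrier_mat (r - n) n.
        \<exists>D \<in> carrier_mat (r - n) (r - n). Zs ! i = four_block_mat (As ! i) B C D)"

definition upper_right_block :: "nat \<Rightarrow> 'a mat \<Rightarrow> 'a mat" where
  "upper_right_block n Z = (case split_block Z n n of (A, B, C, D) \<Rightarrow> B)"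

lemma upper_right_block_four_block_mat:
  assumes "A \<in> carrier_mat n n" "B \<in> carrier_mat n m" "C \<in> carrier_mat m n" "D \<in> carrier_mat m m"
  shows "upper_right_block n (four_block_mat A B C D) = B"
  using assms by (intro eq_matI) (auto simp: upper_right_block_def split_block_def Let_def)

lemma subspace_plus_eq: "subspace_plus n U W = {u + w | u w. u \<in> U \<and> w \<in> W}"
  by (auto simp: subspace_plus_def module_vec_simps image_iff
      LinearCombinations.module.submodule_sum_def[OF vec_module[where n = n]])

lemma subspace_dim_column_space:
  fixes A :: "'a::field mat"
  assumes "A \<in> carrier_mat n m"
  shows "subspace_dim n (column_space A) = vec_space.rank n A"
  using assms by (simp add: subspace_dim_def column_space_def vec_space.rank_def)

end

theory Submission
  imports Defs
begin

text \<open>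
  Put \<open>m = r - n\<close>. Commutation of the extensions gives \<open>[A\<^sub>i, A\<^sub>j] = B\<^sub>j C\<^sub>i - B\<^sub>i C\<^sub>j\<close>, so the rank
  hypotheses force the columns of \<open>(B\<^sub>1 | B\<^sub>2 | B\<^sub>3)\<close> to be independent and each pair \<open>(C\<^sub>i, C\<^sub>j)\<close> to
  map onto \<open>K\<^sup>m \<times> K\<^sup>m\<close>. Hence \<open>Im B\<^sub>i = Im [A\<^sub>i, A\<^sub>j] \<inter> Im [A\<^sub>i, A\<^sub>k]\<close> depends only on the
  \<open>A\<close>'s, and \<open>B'\<^sub>i = B\<^sub>i G\<^sub>i\<close> for some \<open>G\<^sub>i\<close>. Comparing the two expressions of a commutator yields
  \<open>C\<^sub>i = G\<^sub>j C'\<^sub>i\<close> for all \<open>j \<noteq> i\<close>; as \<open>C'\<^sub>i\<close> is onto, all \<open>G\<^sub>j\<close> coincide, and \<open>G\<^sub>1 = 1\<close>.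
  Finally \<open>A\<^sub>i B\<^sub>j + B\<^sub>i D\<^sub>j = A\<^sub>j B\<^sub>i + B\<^sub>j D\<^sub>i\<close> and the independence determine the \<open>D\<^sub>i\<close>.
\<close>

section \<open>Column spaces, rank and factorizations through K^k\<close>

lemma column_space_eq:
  fixes A :: "'a::field mat"
  assumes "A \<in> carrier_mat n k"
  shows "column_space A = (*\<^sub>v) A ` carrier_vec k"
proof -
  interpret vec_space "TYPE('a)" n .
  have "column_space A = col_space A"
    using assms by (simp add: column_space_def col_space_def)
  then show ?thesis
    using assms by (auto simp: col_space_eq)
qed

lemma column_space_mult:
  fixes P :: "'a::field mat"
  assumes "P \<in> carrier_mat n k" "Q \<in> carrier_mat k p"
  shows "column_space (P * Q) = (*\<^sub>v) P ` column_space Q"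
  unfolding column_space_eq[OF mult_carrier_mat[OF assms]] column_space_eq[OF assms(2)] image_image
  by (rule image_cong) (use assms in auto)

text \<open>Serves to replace a matrix by one with the same column space whose number of columns is
  the dimension of that space; \<open>full_rank_factor\<close> then bounds a rank by counting
  columns.\<close>

lemma column_space_indpt_cols:
  fixes Q :: "'a::field mat"
  assumes Q: "Q \<in> carrier_mat k p"
  obtains b where "distinct b" "set b \<subseteq> carrier_vec k"
    "\<not> LinearCombinations.module.lin_dep class_ring (module_vec TYPE('a) k) (set b)"
    "column_space (mat_of_cols k b) = column_space Q"
proof -
  interpret vec_space "TYPE('a)" k .
  let ?U = "span (set (cols Q))"
  have cols: "set (cols Q) \<subseteq> carrier_vec k"
    using Q cols_dim by blast
  have sub: "submodule class_ring ?U V"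
    by (rule span_is_submodule) (use cols in simp)
  have vs: "vectorspace class_ring (vs ?U)"
    using sub by (simp add: subspace_def subspace_is_vs vectorspace_axioms)
  obtain B where B: "finite B" "vectorspace.basis class_ring (vs ?U) B"
    using vectorspace.finite_basis_exists[OF vs fin_dim_span_cols[OF Q]] by blast
  then have BU: "B \<subseteq> ?U"
    and gen: "LinearCombinations.module.span class_ring (vs ?U) B = ?U"
    and li: "\<not> LinearCombinations.module.lin_dep class_ring (vs ?U) B"
    by (simp_all add: vectorspace.basis_def[OF vs])
  obtain b where b: "distinct b" "set b = B"
    using finite_distinct_list[OF B(1)] by blast
  have "B \<subseteq> carrier_vec k"
    using BU cols span_closed by auto
  \<comment> \<open>The basis lives in the subspace \<open>vs ?U\<close>;
    \<open>span_li_not_depend\<close> carries its span and its independence over to K^k.\<close>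
  then show ?thesis
    using that[of b] b gen li span_li_not_depend[OF BU sub] Q
    by (simp add: column_space_def)
qed

lemma subspace_dim_column_space_le:
  fixes A :: "'a::field mat"
  assumes "A \<in> carrier_mat n k"
  shows "subspace_dim n (column_space A) \<le> k"
  using assms vec_space.rank_le_nc by (simp add: subspace_dim_column_space)

text \<open>Rank equal to the number of columns makes the columns independent, so a vector of the
  kernel, being a linear relation between them, is zero.\<close>

lemma full_rank_inj:
  fixes P :: "'a::field mat"
  assumes P: "P \<in> carrier_mat n k"
    and dim: "subspace_dim n (column_space P) = k"
    and x: "x \<in> carrier_vec k" "P *\<^sub>v x = 0\<^sub>v n"
  shows "x = 0\<^sub>v k"
proof -
  interpret vec_space "TYPE('a)" n .
  have rk: "rank P = k"
    using dim P by (simp add: subspace_dim_column_space)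
  obtain S where S: "maximal S (\<lambda>T. T \<subseteq> set (cols P) \<and> lin_indpt T)"
    using maximal_exists_superset[of "set (cols P)" "\<lambda>T. T \<subseteq> set (cols P) \<and> lin_indpt T" "{}"]
      finite_lin_indpt2[of "{}"] by auto
  \<comment> \<open>Independence is a notion for sets, so a repeated column would go unnoticed. A
    maximal independent set of columns has \<open>rank P = k\<close> elements, hence the
    \<open>k\<close> columns are distinct.\<close>
  have "k \<le> card (set (cols P))"
    using rank_card_indpt[OF P S] rk S card_mono[of "set (cols P)" S]
    by (simp add: maximal_def)
  then have dist: "distinct (cols P)"
    using P card_length[of "cols P"] by (intro card_distinct) auto
  then show ?thesis
    using lin_depI[OF P x(1) _ x(2) dist] full_rank_lin_indpt[OF P rk dist] by blast
qed

text \<open>The column space of \<open>P * Q\<close> is the image under \<open>P\<close> of that of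
  \<open>Q\<close>, so \<open>Q\<close> has rank at least \<open>k\<close> and is onto K^k. Then
  \<open>P\<close> and \<open>P * Q\<close> have the same column space, and \<open>P\<close>, with
  \<open>k\<close> columns and rank \<open>k\<close>, is injective.\<close>

lemma full_rank_factor:
  fixes P Q :: "'a::field mat"
  assumes P: "P \<in> carrier_mat n k" and Q: "Q \<in> carrier_mat k p"
    and dim: "subspace_dim n (column_space (P * Q)) = k"
  shows "column_space Q = carrier_vec k"
    and "\<And>x. x \<in> carrier_vec k \<Longrightarrow> P *\<^sub>v x = 0\<^sub>v n \<Longrightarrow> x = 0\<^sub>v k"
proof -
  interpret vec_space "TYPE('a)" k .
  obtain b where b: "distinct b" "set b \<subseteq> carrier_vec k" "lin_indpt (set b)"
      "column_space (mat_of_cols k b) = column_space Q"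
    by (rule column_space_indpt_cols[OF Q])
  have R: "mat_of_cols k b \<in> carrier_mat k (length b)"
    by simp
  \<comment> \<open>The right-hand product has only \<open>length b\<close> columns, so the
    dimension \<open>k\<close> is at most the number of independent vectors in \<open>b\<close>,
    which therefore form a basis of K^k.\<close>
  have "column_space (P * Q) = column_space (P * mat_of_cols k b)"
    using b(4) by (simp add: column_space_mult[OF P Q] column_space_mult[OF P R])
  then have "k \<le> card (set b)"
    using subspace_dim_column_space_le[OF mult_carrier_mat[OF P R]] dim b(1)
    by (simp add: distinct_card)
  then have "span (set b) = carrier_vec k"
    using dim_li_is_basis[of "set b"] b by (simp add: dim_is_n basis_def)
  then show surj: "column_space Q = carrier_vec k"
    using b(2,4) by (simp add: column_space_def)
  have "column_space P = column_space (P * Q)"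
    using surj P by (auto simp: column_space_mult[OF P Q] column_space_eq)
  then show "\<And>x. x \<in> carrier_vec k \<Longrightarrow> P *\<^sub>v x = 0\<^sub>v n \<Longrightarrow> x = 0\<^sub>v k"
    using full_rank_inj[OF P] dim by simp
qed

section \<open>Juxtaposed blocks and the rank hypotheses\<close>

definition append_cols :: "'a::zero mat \<Rightarrow> 'a mat \<Rightarrow> 'a mat" where
  "append_cols A B = four_block_mat A B (0\<^sub>m 0 (dim_col A)) (0\<^sub>m 0 (dim_col B))"

lemma append_cols_carrier [simp]:
  assumes "A \<in> carrier_mat n k" "B \<in> carrier_mat n l"
  shows "append_cols A B \<in> carrier_mat n (k + l)"
  using assms by (auto simp: append_cols_def)

lemma append_cols_mult_vec:
  fixes A :: "'a::field mat"
  assumes "A \<in> carrier_mat n k" "B \<in> carrier_mat n l" "x \<in> carrier_vec k" "y \<in> carrier_vec l"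
  shows "append_cols A B *\<^sub>v (x @\<^sub>v y) = A *\<^sub>v x + B *\<^sub>v y"
proof -
  \<comment> \<open>The lower blocks have no rows, so the vector appended here has dimension
    0.\<close>
  have "append_cols A B *\<^sub>v (x @\<^sub>v y) = (A *\<^sub>v x + B *\<^sub>v y) @\<^sub>v 
      (0\<^sub>m 0 k *\<^sub>v x + 0\<^sub>m 0 l *\<^sub>v y)"
    unfolding append_cols_def using assms by (subst four_block_mat_mult_vec) auto
  also have "\<dots> = A *\<^sub>v x + B *\<^sub>v y"
    by (rule eq_vecI) (use assms in auto)
  finally show ?thesis .
qed

lemma mult_mat_vec_uminus:
  fixes A :: "'a::ring mat"
  assumes "A \<in> carrier_mat n k" "v \<in> carrier_vec k"
  shows "A *\<^sub>v (- v) = - (A *\<^sub>v v)"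
  using assms by (intro eq_vecI) auto

lemma mult_mat_zero_vec:
  fixes A :: "'a::field mat"
  assumes "A \<in> carrier_mat n k"
  shows "A *\<^sub>v 0\<^sub>v k = 0\<^sub>v n"
  using assms by (intro eq_vecI) auto

lemma carrier_vec_add:
  "carrier_vec (n + m) = {x @\<^sub>v y | x y. x \<in> carrier_vec n \<and> y \<in> carrier_vec m}"
  using all_vec_append[of n m "\<lambda>z. \<exists>x y. z = x @\<^sub>v y \<and> x \<in> carrier_vec n \<and> y \<in> carrier_vec m"]
  by auto

text \<open>The commutator factors through K^(2m) as the block row (B2 | -B1) times the column of
  blocks C1 over C2. Rank 2m makes the right factor onto.\<close>

lemma lower_left_blocks_jointly_surj:
  fixes B1 B2 C1 C2 :: "'a::field mat"
  assumes B: "B1 \<in> carrier_mat n m" "B2 \<in> carrier_mat n m"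
    and C: "C1 \<in> carrier_mat m n" "C2 \<in> carrier_mat m n"
    and dim: "subspace_dim n (column_space (B2 * C1 - B1 * C2)) = 2 * m"
    and uv: "u \<in> carrier_vec m" "v \<in> carrier_vec m"
  obtains w where "w \<in> carrier_vec n" "C1 *\<^sub>v w = u" "C2 *\<^sub>v w = v"
proof -
  let ?P = "append_cols B2 (- B1)" and ?Q = "C1 @\<^sub>r C2"
  have P: "?P \<in> carrier_mat n (m + m)" and Q: "?Q \<in> carrier_mat (m + m) n"
    using B C by auto
  have M: "B2 * C1 - B1 * C2 \<in> carrier_mat n n"
    using B C by auto
  have "?P *\<^sub>v (?Q *\<^sub>v w) = (B2 * C1 - B1 * C2) *\<^sub>v w" if "w \<in> carrier_vec n" for w
    using that B C
    by (simp add: mat_mult_append[of C1 m n C2 m] minus_mult_distrib_mat_vec[of _ n n] uminus_mult_mat_vec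
        minus_add_uminus_vec[of _ n] append_cols_mult_vec[of _ n m _ m])
  then have "column_space (?P * ?Q) = column_space (B2 * C1 - B1 * C2)"
    unfolding column_space_mult[OF P Q] column_space_eq[OF Q] column_space_eq[OF M] image_image
    by (rule image_cong[OF refl])
  then have "column_space ?Q = carrier_vec (m + m)"
    using full_rank_factor(1)[OF P Q] dim by simp
  moreover have "u @\<^sub>v v \<in> carrier_vec (m + m)"
    using uv by simp
  ultimately obtain w where w: "w \<in> carrier_vec n" "?Q *\<^sub>v w = u @\<^sub>v v"
    unfolding column_space_eq[OF Q] by (metis imageE)
  then show ?thesis
    using that[of w] uv C by (simp add: mat_mult_append[of C1 m n C2 m] append_vec_eq[of _ m])
qed

text \<open>The sum of the two column spaces is the column space of the juxtaposed commutators. That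
  matrix factors through K^(3m) as (B1 | B2 | B3) times the matrix with block rows (-C2 | -C3), (C1
  | 0), (0 | C1). Rank 3m makes the left factor injective.\<close>

lemma upper_right_blocks_indpt:
  fixes B1 B2 B3 C1 C2 C3 :: "'a::field mat"
  assumes B: "B1 \<in> carrier_mat n m" "B2 \<in> carrier_mat n m" "B3 \<in> carrier_mat n m"
    and C: "C1 \<in> carrier_mat m n" "C2 \<in> carrier_mat m n" "C3 \<in> carrier_mat m n"
    and dim: "subspace_dim n (subspace_plus n (column_space (B2 * C1 - B1 * C2))
      (column_space (B3 * C1 - B1 * C3))) = 3 * m"
    and xyz: "x \<in> carrier_vec m" "y \<in> carrier_vec m" "z \<in> carrier_vec m"
    and zero: "B1 *\<^sub>v x + B2 *\<^sub>v y + B3 *\<^sub>v z = 0\<^sub>v n"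
  shows "x = 0\<^sub>v m \<and> y = 0\<^sub>v m \<and> z = 0\<^sub>v m"
proof -
  let ?P = "append_cols B1 (append_cols B2 B3)"
    and ?Q = "append_cols (- C2) (- C3) @\<^sub>r (append_cols C1 (0\<^sub>m m n) @\<^sub>r append_cols (0\<^sub>m m n) C1)"
  have P: "?P \<in> carrier_mat n (m + (m + m))" and Q: "?Q \<in> carrier_mat (m + (m + m)) (n + n)"
    using B C by auto
  have M: "B2 * C1 - B1 * C2 \<in> carrier_mat n n" "B3 * C1 - B1 * C3 \<in> carrier_mat n n"
    using B C by auto
  have Qw: "?Q *\<^sub>v (w @\<^sub>v w') = (- (C2 *\<^sub>v w) - C3 *\<^sub>v w') @\<^sub>v (C1 *\<^sub>v w @\<^sub>v C1 *\<^sub>v w')"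
    if "w \<in> carrier_vec n" "w' \<in> carrier_vec n" for w w'
  proof -
    have "0\<^sub>m m n *\<^sub>v u = 0\<^sub>v m" if "u \<in> carrier_vec n" for u :: "'a vec"
      using that by (intro eq_vecI) auto
    then show ?thesis
      using that C
    by (simp add: mat_mult_append[of _ m "n + n" _ "m + m"] mat_mult_append[of _ m "n + n" _ m]
        append_cols_mult_vec[of _ m n _ n] uminus_mult_mat_vec minus_add_uminus_vec[of _ m])
  qed
  have eq: "?P *\<^sub>v (?Q *\<^sub>v (w @\<^sub>v w')) =
      (B2 * C1 - B1 * C2) *\<^sub>v w + (B3 * C1 - B1 * C3) *\<^sub>v w'"
    if w: "w \<in> carrier_vec n" "w' \<in> carrier_vec n" for w w'
  proof -
    have "?P *\<^sub>v (?Q *\<^sub>v (w @\<^sub>v w')) =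
        B1 *\<^sub>v (- (C2 *\<^sub>v w) - C3 *\<^sub>v w') + (B2 *\<^sub>v (C1 *\<^sub>v w) + B3 *\<^sub>v (C1 *\<^sub>v w'))"
      unfolding Qw[OF w] using w B C
      by (simp add: append_cols_mult_vec[of _ n m _ "m + m"] append_cols_mult_vec[of _ n m _ m])
    also have "B1 *\<^sub>v (- (C2 *\<^sub>v w) - C3 *\<^sub>v w') = - (B1 *\<^sub>v (C2 *\<^sub>v w)) - B1 *\<^sub>v (C3 *\<^sub>v w')"
      using w B C by (simp add: mult_minus_distrib_mat_vec[of _ n m] mult_mat_vec_uminus[of _ n m])
    finally show ?thesis
      using w B C
      by (intro eq_vecI)
        (simp_all add: minus_mult_distrib_mat_vec[of _ n n] del: index_mult_mat_vec)
  qed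
  \<comment> \<open>Splitting the argument in K^(2n) as \<open>w @\<^sub>v w'\<close> turns the
    column space of the product into the sum of two column spaces.\<close>
  have "column_space (?P * ?Q) = {?P *\<^sub>v (?Q *\<^sub>v (w @\<^sub>v w')) | w w'.
      w \<in> carrier_vec n \<and> w' \<in> carrier_vec n}"
    unfolding column_space_mult[OF P Q] column_space_eq[OF Q] image_image carrier_vec_add by blast
  also have "\<dots> = {(B2 * C1 - B1 * C2) *\<^sub>v w + (B3 * C1 - B1 * C3) *\<^sub>v w' | w w'.
      w \<in> carrier_vec n \<and> w' \<in> carrier_vec n}"
    by (rule Collect_cong) (metis eq)
  also have "\<dots> = subspace_plus n (column_space (B2 * C1 - B1 * C2)) (column_space (B3 * C1 - B1 * C3))"
    unfolding subspace_plus_eq column_space_eq[OF M(1)] column_space_eq[OF M(2)] by blast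
  finally have "x @\<^sub>v y @\<^sub>v z = 0\<^sub>v (m + (m + m))"
    using B xyz zero dim
    by (intro full_rank_factor(2)[OF P Q])
      (simp_all add: append_cols_mult_vec[of _ n m _ "m + m"] append_cols_mult_vec[of _ n m _ m]
        assoc_add_vec[of _ n])
  also have "\<dots> = 0\<^sub>v m @\<^sub>v 0\<^sub>v m @\<^sub>v 0\<^sub>v m"
    by (rule eq_vecI) auto
  finally show ?thesis
    using xyz by (simp add: append_vec_eq[of _ m])
qed

section \<open>Block identities from commutation\<close>

lemma mat_eq_by_mult_vec:
  fixes A B :: "'a::field mat"
  assumes "A \<in> carrier_mat n k" "B \<in> carrier_mat n k"
    and "\<And>x. x \<in> carrier_vec k \<Longrightarrow> A *\<^sub>v x = B *\<^sub>v x"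
  shows "A = B"
proof (rule eq_matI)
  fix i j assume "i < dim_row B" "j < dim_col B"
  then show "A $$ (i, j) = B $$ (i, j)"
    using assms(1,2) arg_cong[OF assms(3)[of "unit_vec k j"], of "\<lambda>v. v $ i"]
    by (simp add: scalar_prod_right_unit)
qed (use assms in auto)

lemma four_block_mat_inj_upper:
  assumes "A \<in> carrier_mat n n" "B \<in> carrier_mat n m" "D \<in> carrier_mat m m"
    "A' \<in> carrier_mat n n" "B' \<in> carrier_mat n m" "D' \<in> carrier_mat m m"
    and eq: "four_block_mat A B C D = four_block_mat A' B' C' D'"
  shows "A = A'" "B = B'"
proof -
  have entry: "four_block_mat A B C D $$ (i, j) = four_block_mat A' B' C' D' $$ (i, j)" for i j
    using eq by simp
  show "A = A'"
  proof (rule eq_matI)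
    fix i j assume "i < dim_row A'" "j < dim_col A'"
    then show "A $$ (i, j) = A' $$ (i, j)"
      using entry[of i j] assms(1-6) by auto
  qed (use assms in auto)
  show "B = B'"
  proof (rule eq_matI)
    fix i j assume "i < dim_row B'" "j < dim_col B'"
    then show "B $$ (i, j) = B' $$ (i, j)"
      using entry[of i "n + j"] assms(1-6) by auto
  qed (use assms in auto)
qed

text \<open>Both identities are read off the upper blocks of the two products: the upper left ones
  give the commutator, the upper right ones the relation between the \<open>D\<close>'s.\<close>

lemma commuting_blocks:
  fixes A1 A2 :: "'a::field mat"
  assumes A: "A1 \<in> carrier_mat n n" "A2 \<in> carrier_mat n n"
    and B: "B1 \<in> carrier_mat n m" "B2 \<in> carrier_mat n m"
    and C: "C1 \<in> carrier_mat m n" "C2 \<in> carrier_mat m n"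
    and D: "D1 \<in> carrier_mat m m" "D2 \<in> carrier_mat m m"
    and comm: "four_block_mat A1 B1 C1 D1 * four_block_mat A2 B2 C2 D2 =
      four_block_mat A2 B2 C2 D2 * four_block_mat A1 B1 C1 D1"
  shows "commutator A1 A2 = B2 * C1 - B1 * C2"
    and "A1 * B2 + B1 * D2 = A2 * B1 + B2 * D1"
proof -
  have eq: "four_block_mat (A1 * A2 + B1 * C2) (A1 * B2 + B1 * D2) (C1 * A2 + D1 * C2) (C1 * B2 + D1 * D2) =
      four_block_mat (A2 * A1 + B2 * C1) (A2 * B1 + B2 * D1) (C2 * A1 + D2 * C1) (C2 * B1 + D2 * D1)"
    using comm
    by (simp add: mult_four_block_mat[OF A(1) B(1) C(1) D(1) A(2) B(2) C(2) D(2)]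
        mult_four_block_mat[OF A(2) B(2) C(2) D(2) A(1) B(1) C(1) D(1)])
  show "A1 * B2 + B1 * D2 = A2 * B1 + B2 * D1"
    by (rule four_block_mat_inj_upper(2)[OF _ _ _ _ _ _ eq, of n m]) (use A B C D in auto)
  have upper: "A1 * A2 + B1 * C2 = A2 * A1 + B2 * C1"
    by (rule four_block_mat_inj_upper(1)[OF _ _ _ _ _ _ eq, of n m]) (use A B C D in auto)
  show "commutator A1 A2 = B2 * C1 - B1 * C2"
  proof (rule eq_matI)
    fix i j assume ij: "i < dim_row (B2 * C1 - B1 * C2)" "j < dim_col (B2 * C1 - B1 * C2)"
    have "(A1 * A2 + B1 * C2) $$ (i, j) = (A2 * A1 + B2 * C1) $$ (i, j)"
      using upper by simp
    then show "commutator A1 A2 $$ (i, j) = (B2 * C1 - B1 * C2) $$ (i, j)"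
      using ij A B C unfolding commutator_def
      \<comment> \<open>Entries of products are kept as atoms instead of being unfolded to scalar
        products, so that only additive rearrangement remains.\<close>
      by (simp del: index_mult_mat(1)) (simp add: algebra_simps del: index_mult_mat(1))
  qed (use A B C in \<open>auto simp: commutator_def\<close>)
qed

section \<open>Determining the blocks from the commutators\<close>

lemma indpt_cancel:
  fixes B E :: "'a::field mat"
  assumes BE: "B \<in> carrier_mat n m" "E \<in> carrier_mat n m"
    and inj: "\<forall>x\<in>carrier_vec m. \<forall>y\<in>carrier_vec m.
      B *\<^sub>v x + E *\<^sub>v y = 0\<^sub>v n \<longrightarrow> x = 0\<^sub>v m \<and> y = 0\<^sub>v m"
    and xy: "x \<in> carrier_vec m" "y \<in> carrier_vec m" "x' \<in> carrier_vec m" "y' \<in> carrier_vec m"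
    and eq: "B *\<^sub>v x - E *\<^sub>v y = B *\<^sub>v x' - E *\<^sub>v y'"
  shows "x = x'" "y = y'"
proof -
  \<comment> \<open>Commutators come as differences, so the second coefficient appears with reversed
    sign.\<close>
  have "B *\<^sub>v (x - x') + E *\<^sub>v (y' - y) = 0\<^sub>v n"
  proof (rule eq_vecI)
    fix i assume i: "i < dim_vec (0\<^sub>v n :: 'a vec)"
    have "(B *\<^sub>v x - E *\<^sub>v y) $ i = (B *\<^sub>v x' - E *\<^sub>v y') $ i"
      using eq by simp
    then show "(B *\<^sub>v (x - x') + E *\<^sub>v (y' - y)) $ i = 0\<^sub>v n $ i"
      using i BE xy
      by (simp add: mult_minus_distrib_mat_vec[of _ n m] algebra_simps del: index_mult_mat_vec)
  qed (use BE in auto)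
  then have z: "x - x' = 0\<^sub>v m" "y' - y = 0\<^sub>v m"
    using inj minus_carrier_vec[OF xy(1,3)] minus_carrier_vec[OF xy(4,2)] by blast+
  have "x $ i = x' $ i" "y $ i = y' $ i" if "i < m" for i
    using arg_cong[OF z(1), of "\<lambda>v. v $ i"] arg_cong[OF z(2), of "\<lambda>v. v $ i"] that xy by auto
  then show "x = x'" "y = y'"
    using xy by (auto intro!: eq_vecI)
qed

text \<open>Gives Im B1' \<subseteq> Im B1. By surjectivity, \<open>- (B1' *\<^sub>v x)\<close> is a
  value of both [A1,A2] and [A1,A3]; the unprimed expressions put it in Im B1 + Im B2 and in Im B1 +
  Im B3, which meet in Im B1 by independence. Permuting the indices gives the same for B2' and
  B3'.\<close>

lemma upper_right_block_image:
  fixes B1 B2 B3 B1' B2' B3' C1 C2 C3 C1' C2' C3' :: "'a::field mat"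
  assumes B: "B1 \<in> carrier_mat n m" "B2 \<in> carrier_mat n m" "B3 \<in> carrier_mat n m"
    and C: "C1 \<in> carrier_mat m n" "C2 \<in> carrier_mat m n" "C3 \<in> carrier_mat m n"
    and B': "B1' \<in> carrier_mat n m" "B2' \<in> carrier_mat n m" "B3' \<in> carrier_mat n m"
    and C': "C1' \<in> carrier_mat m n" "C2' \<in> carrier_mat m n" "C3' \<in> carrier_mat m n"
    and inj: "\<And>x y z. x \<in> carrier_vec m \<Longrightarrow> y \<in> carrier_vec m \<Longrightarrow> z \<in> carrier_vec m \<Longrightarrow>
      B1 *\<^sub>v x + B2 *\<^sub>v y + B3 *\<^sub>v z = 0\<^sub>v n \<Longrightarrow> y = 0\<^sub>v m"
    and surj12: "\<And>u v. u \<in> carrier_vec m \<Longrightarrow> v \<in> carrier_vec m \<Longrightarrow>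
      \<exists>w\<in>carrier_vec n. C1' *\<^sub>v w = u \<and> C2' *\<^sub>v w = v"
    and surj13: "\<And>u v. u \<in> carrier_vec m \<Longrightarrow> v \<in> carrier_vec m \<Longrightarrow>
      \<exists>w\<in>carrier_vec n. C1' *\<^sub>v w = u \<and> C3' *\<^sub>v w = v"
    and e12: "\<And>w. w \<in> carrier_vec n \<Longrightarrow> B2 *\<^sub>v (C1 *\<^sub>v w) - B1 *\<^sub>v (C2 *\<^sub>v w) =
      B2' *\<^sub>v (C1' *\<^sub>v w) - B1' *\<^sub>v (C2' *\<^sub>v w)"
    and e13: "\<And>w. w \<in> carrier_vec n \<Longrightarrow> B3 *\<^sub>v (C1 *\<^sub>v w) - B1 *\<^sub>v (C3 *\<^sub>v w) =
      B3' *\<^sub>v (C1' *\<^sub>v w) - B1' *\<^sub>v (C3' *\<^sub>v w)"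
    and x: "x \<in> carrier_vec m"
  shows "\<exists>v\<in>carrier_vec m. B1' *\<^sub>v x = B1 *\<^sub>v v"
proof -
  obtain w where w: "w \<in> carrier_vec n" "C1' *\<^sub>v w = 0\<^sub>v m" "C2' *\<^sub>v w = x"
    using surj12[of "0\<^sub>v m" x] x by auto
  obtain w' where w': "w' \<in> carrier_vec n" "C1' *\<^sub>v w' = 0\<^sub>v m" "C3' *\<^sub>v w' = x"
    using surj13[of "0\<^sub>v m" x] x by auto
  have 2: "B2 *\<^sub>v (C1 *\<^sub>v w) - B1 *\<^sub>v (C2 *\<^sub>v w) = - (B1' *\<^sub>v x)"
    using e12[OF w(1)] w x mult_mat_zero_vec[OF B'(2)] B' by auto
  have 3: "B3 *\<^sub>v (C1 *\<^sub>v w') - B1 *\<^sub>v (C3 *\<^sub>v w') = - (B1' *\<^sub>v x)"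
    using e13[OF w'(1)] w' x mult_mat_zero_vec[OF B'(3)] B' by auto
  \<comment> \<open>This is the difference of the two expressions of
    \<open>- (B1' *\<^sub>v x)\<close>. Its B2-coefficient \<open>C1 *\<^sub>v w\<close> must
    vanish, which turns the first expression into \<open>- (B1 *\<^sub>v (C2 *\<^sub>v w))\<close>
    and supplies the witness.\<close>
  have "B1 *\<^sub>v (C3 *\<^sub>v w' - C2 *\<^sub>v w) + B2 *\<^sub>v (C1 *\<^sub>v w) + B3 *\<^sub>v (- (C1 *\<^sub>v w')) = 0\<^sub>v n"
  proof (rule eq_vecI)
    fix i assume i: "i < dim_vec (0\<^sub>v n :: 'a vec)"
    have "(B2 *\<^sub>v (C1 *\<^sub>v w) - B1 *\<^sub>v (C2 *\<^sub>v w)) $ i = (B3 *\<^sub>v (C1 *\<^sub>v w') - B1 *\<^sub>v (C3 *\<^sub>v w')) $ i"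
      using 2 3 by simp
    then show "(B1 *\<^sub>v (C3 *\<^sub>v w' - C2 *\<^sub>v w) + B2 *\<^sub>v (C1 *\<^sub>v w) + B3 *\<^sub>v (- (C1 *\<^sub>v w'))) $ i
        = 0\<^sub>v n $ i"
      using i w w' B C
      by (simp add: mult_minus_distrib_mat_vec[of _ n m] mult_mat_vec_uminus[of _ n m] algebra_simps
          del: index_mult_mat_vec)
  qed (use B in auto)
  then have C1w: "C1 *\<^sub>v w = 0\<^sub>v m"
    using inj[of "C3 *\<^sub>v w' - C2 *\<^sub>v w" "C1 *\<^sub>v w" "- (C1 *\<^sub>v w')"] w w' C by simp
  have "- (B1 *\<^sub>v (C2 *\<^sub>v w)) = - (B1' *\<^sub>v x)"
    using 2 C1w mult_mat_zero_vec[OF B(2)] w B C by (simp add: minus_add_uminus_vec[of _ n])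
  then show ?thesis
    using w C by (intro bexI[of _ "C2 *\<^sub>v w"]) auto
qed

text \<open>Here B1' = B1 is built in. Each B_i' factors pointwise through B_i by a map
  \<open>f2\<close> or \<open>f3\<close>; comparing coefficients in the three commutators forces
  both maps to be the identity.\<close>

lemma off_diagonal_blocks_unique:
  fixes B1 B2 B3 B1' B2' B3' C1 C2 C3 C1' C2' C3' :: "'a::field mat"
  assumes B: "B1 \<in> carrier_mat n m" "B2 \<in> carrier_mat n m" "B3 \<in> carrier_mat n m"
    and C: "C1 \<in> carrier_mat m n" "C2 \<in> carrier_mat m n" "C3 \<in> carrier_mat m n"
    and B': "B2' \<in> carrier_mat n m" "B3' \<in> carrier_mat n m"
    and C': "C1' \<in> carrier_mat m n" "C2' \<in> carrier_mat m n" "C3' \<in> carrier_mat m n"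
    and inj: "\<And>x y z. x \<in> carrier_vec m \<Longrightarrow> y \<in> carrier_vec m \<Longrightarrow> z \<in> carrier_vec m \<Longrightarrow>
      B1 *\<^sub>v x + B2 *\<^sub>v y + B3 *\<^sub>v z = 0\<^sub>v n \<Longrightarrow> x = 0\<^sub>v m \<and> y = 0\<^sub>v m \<and> z = 0\<^sub>v m"
    and surj12: "\<And>u v. u \<in> carrier_vec m \<Longrightarrow> v \<in> carrier_vec m \<Longrightarrow>
      \<exists>w\<in>carrier_vec n. C1' *\<^sub>v w = u \<and> C2' *\<^sub>v w = v"
    and surj13: "\<And>u v. u \<in> carrier_vec m \<Longrightarrow> v \<in> carrier_vec m \<Longrightarrow>
      \<exists>w\<in>carrier_vec n. C1' *\<^sub>v w = u \<and> C3' *\<^sub>v w = v"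
    and surj23: "\<And>u v. u \<in> carrier_vec m \<Longrightarrow> v \<in> carrier_vec m \<Longrightarrow>
      \<exists>w\<in>carrier_vec n. C2' *\<^sub>v w = u \<and> C3' *\<^sub>v w = v"
    and e12: "B2 * C1 - B1 * C2 = B2' * C1' - B1 * C2'"
    and e13: "B3 * C1 - B1 * C3 = B3' * C1' - B1 * C3'"
    and e23: "B3 * C2 - B2 * C3 = B3' * C2' - B2' * C3'"
  shows "B2 = B2'" "B3 = B3'" "C1 = C1'" "C2 = C2'" "C3 = C3'"
proof -
  have vec: "E *\<^sub>v (F *\<^sub>v w) - G *\<^sub>v (H *\<^sub>v w) = E' *\<^sub>v (F' *\<^sub>v w) - G' *\<^sub>v (H' *\<^sub>v w)"
    if "E * F - G * H = E' * F' - G' * H'" "w \<in> carrier_vec n"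
      "E \<in> carrier_mat n m" "G \<in> carrier_mat n m" "E' \<in> carrier_mat n m" "G' \<in> carrier_mat n m"
      "F \<in> carrier_mat m n" "H \<in> carrier_mat m n" "F' \<in> carrier_mat m n" "H' \<in> carrier_mat m n"
    for E F G H E' F' G' H' :: "'a mat" and w
  proof -
    have "(E * F - G * H) *\<^sub>v w = (E' * F' - G' * H') *\<^sub>v w"
      using that by simp
    then show ?thesis
      using that(2-) by (simp add: minus_mult_distrib_mat_vec[of _ n n])
  qed
  have swap: "E * F - G * H = E' * F' - G' * H'" if "G * H - E * F = G' * H' - E' * F'"
      "E \<in> carrier_mat n m" "G \<in> carrier_mat n m" "E' \<in> carrier_mat n m" "G' \<in> carrier_mat n m"
      "F \<in> carrier_mat m n" "H \<in> carrier_mat m n" "F' \<in> carrier_mat m n" "H' \<in> carrier_mat m n"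
    for E F G H E' F' G' H' :: "'a mat"
  proof (rule eq_matI)
    fix i j assume "i < dim_row (E' * F' - G' * H')" "j < dim_col (E' * F' - G' * H')"
    then show "(E * F - G * H) $$ (i, j) = (E' * F' - G' * H') $$ (i, j)"
      using arg_cong[OF that(1), of "\<lambda>M. M $$ (i, j)"] that(2-)
      by (simp add: algebra_simps del: index_mult_mat(1))
  qed (use that in auto)
  \<comment> \<open>Fact \<open>vij\<close> equates the two expressions of [A_i, A_j] at a vector.
    The reversed orders, obtained by antisymmetry, are for \<open>upper_right_block_image\<close>,
    which singles out its first index.\<close>
  note v12 = vec[OF e12 _ B(2,1) B'(1) B(1) C(1,2) C'(1,2)]
   and v13 = vec[OF e13 _ B(3,1) B'(2) B(1) C(1,3) C'(1,3)]
   and v23 = vec[OF e23 _ B(3,2) B'(2,1) C(2,3) C'(2,3)]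
   and v21 = vec[OF swap[OF e12 B(1,2) B(1) B'(1) C(2,1) C'(2,1)] _ B(1,2) B(1) B'(1) C(2,1) C'(2,1)]
   and v31 = vec[OF swap[OF e13 B(1,3) B(1) B'(2) C(3,1) C'(3,1)] _ B(1,3) B(1) B'(2) C(3,1) C'(3,1)]
   and v32 = vec[OF swap[OF e23 B(2,3) B'(1,2) C(3,2) C'(3,2)] _ B(2,3) B'(1,2) C(3,2) C'(3,2)]
  have inj21: "\<forall>x\<in>carrier_vec m. \<forall>y\<in>carrier_vec m.
      B2 *\<^sub>v x + B1 *\<^sub>v y = 0\<^sub>v n \<longrightarrow> x = 0\<^sub>v m \<and> y = 0\<^sub>v m"
    using inj[of _ _ "0\<^sub>v m"] mult_mat_zero_vec[OF B(3)] B by (auto simp: comm_add_vec[of "B2 *\<^sub>v _" n])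
  have inj31: "\<forall>x\<in>carrier_vec m. \<forall>y\<in>carrier_vec m.
      B3 *\<^sub>v x + B1 *\<^sub>v y = 0\<^sub>v n \<longrightarrow> x = 0\<^sub>v m \<and> y = 0\<^sub>v m"
    using inj[of _ "0\<^sub>v m" _] mult_mat_zero_vec[OF B(2)] B by (auto simp: comm_add_vec[of "B3 *\<^sub>v _" n])
  have inj32: "\<forall>x\<in>carrier_vec m. \<forall>y\<in>carrier_vec m.
      B3 *\<^sub>v x + B2 *\<^sub>v y = 0\<^sub>v n \<longrightarrow> x = 0\<^sub>v m \<and> y = 0\<^sub>v m"
    using inj[of "0\<^sub>v m"] mult_mat_zero_vec[OF B(1)] B by (auto simp: comm_add_vec[of "B3 *\<^sub>v _" n])
  note cancel21 = indpt_cancel[OF B(2,1) inj21]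
   and cancel31 = indpt_cancel[OF B(3,1) inj31]
   and cancel32 = indpt_cancel[OF B(3,2) inj32]
  have im2: "\<exists>v\<in>carrier_vec m. B2' *\<^sub>v x = B2 *\<^sub>v v" if x: "x \<in> carrier_vec m" for x
  proof (rule upper_right_block_image[OF B(2,1,3) C(2,1,3) B'(1) B(1) B'(2) C'(2,1,3) _ _ surj23 v21 v23 x])
    fix x y z :: "'a vec" assume "x \<in> carrier_vec m" "y \<in> carrier_vec m" "z \<in> carrier_vec m"
      "B2 *\<^sub>v x + B1 *\<^sub>v y + B3 *\<^sub>v z = 0\<^sub>v n"
    then show "y = 0\<^sub>v m"
      using inj[of y x z] B by (simp add: comm_add_vec[of "B1 *\<^sub>v y" n])
  qed (use surj12 in blast)+
  have im3: "\<exists>v\<in>carrier_vec m. B3' *\<^sub>v x = B3 *\<^sub>v v" if x: "x \<in> carrier_vec m" for x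
  proof (rule upper_right_block_image[OF B(3,1,2) C(3,1,2) B'(2) B(1) B'(1) C'(3,1,2) _ _ _ v31 v32 x])
    fix x y z :: "'a vec" assume "x \<in> carrier_vec m" "y \<in> carrier_vec m" "z \<in> carrier_vec m"
      "B3 *\<^sub>v x + B1 *\<^sub>v y + B2 *\<^sub>v z = 0\<^sub>v n"
    moreover have "B1 *\<^sub>v y + B2 *\<^sub>v z + B3 *\<^sub>v x = B3 *\<^sub>v x + B1 *\<^sub>v y + B2 *\<^sub>v z"
      using B by (intro eq_vecI) (simp_all add: algebra_simps del: index_mult_mat_vec)
    ultimately show "y = 0\<^sub>v m"
      using inj[of y z x] by simp
  qed (use surj13 surj23 in blast)+
  \<comment> \<open>The functions \<open>f2\<close> and \<open>f3\<close> stand for the matrices G2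
    and G3; they are chosen vector by vector.\<close>
  obtain f2 where f2: "\<And>x. x \<in> carrier_vec m \<Longrightarrow> f2 x \<in> carrier_vec m \<and> B2' *\<^sub>v x = B2 *\<^sub>v f2 x"
    using im2 by metis
  obtain f3 where f3: "\<And>x. x \<in> carrier_vec m \<Longrightarrow> f3 x \<in> carrier_vec m \<and> B3' *\<^sub>v x = B3 *\<^sub>v f3 x"
    using im3 by metis
  have CV [simp]: "C1 *\<^sub>v w \<in> carrier_vec m" "C2 *\<^sub>v w \<in> carrier_vec m" "C3 *\<^sub>v w \<in> carrier_vec m"
      "C1' *\<^sub>v w \<in> carrier_vec m" "C2' *\<^sub>v w \<in> carrier_vec m" "C3' *\<^sub>v w \<in> carrier_vec m"
    if "w \<in> carrier_vec n" for w
    using that C C' mult_mat_vec_carrier by blast+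
  have c12: "C1 *\<^sub>v w = f2 (C1' *\<^sub>v w) \<and> C2 *\<^sub>v w = C2' *\<^sub>v w" if w: "w \<in> carrier_vec n" for w
  proof -
    have "B2 *\<^sub>v (C1 *\<^sub>v w) - B1 *\<^sub>v (C2 *\<^sub>v w) = B2 *\<^sub>v f2 (C1' *\<^sub>v w) - B1 *\<^sub>v (C2' *\<^sub>v w)"
      using v12[OF w] f2[OF CV(4)[OF w]] by metis
    from cancel21[OF _ _ _ _ this] show ?thesis
      using CV[OF w] f2 by blast
  qed
  have c13: "C1 *\<^sub>v w = f3 (C1' *\<^sub>v w) \<and> C3 *\<^sub>v w = C3' *\<^sub>v w" if w: "w \<in> carrier_vec n" for w
  proof -
    have "B3 *\<^sub>v (C1 *\<^sub>v w) - B1 *\<^sub>v (C3 *\<^sub>v w) = B3 *\<^sub>v f3 (C1' *\<^sub>v w) - B1 *\<^sub>v (C3' *\<^sub>v w)"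
      using v13[OF w] f3[OF CV(4)[OF w]] by metis
    from cancel31[OF _ _ _ _ this] show ?thesis
      using CV[OF w] f3 by blast
  qed
  have c23: "C2 *\<^sub>v w = f3 (C2' *\<^sub>v w)" if w: "w \<in> carrier_vec n" for w
  proof -
    have "B3 *\<^sub>v (C2 *\<^sub>v w) - B2 *\<^sub>v (C3 *\<^sub>v w) = B3 *\<^sub>v f3 (C2' *\<^sub>v w) - B2 *\<^sub>v f2 (C3' *\<^sub>v w)"
      using v23[OF w] f3[OF CV(5)[OF w]] f2[OF CV(6)[OF w]] by metis
    from cancel32(1)[OF _ _ _ _ this] show ?thesis
      using CV[OF w] f2 f3 by blast
  qed
  \<comment> \<open>Take \<open>w\<close> with both \<open>C1' *\<^sub>v w\<close> and
    \<open>C2' *\<^sub>v w\<close> equal to \<open>x\<close>. Then \<open>C2 *\<^sub>v w\<close> is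
    \<open>x\<close> by \<open>c12\<close> and \<open>f3 x\<close> by \<open>c23\<close>. Next,
    \<open>C1 *\<^sub>v w\<close> is \<open>f2 x\<close> by \<open>c12\<close> and
    \<open>f3 x\<close> by \<open>c13\<close>, so \<open>f2\<close> is the identity as well.\<close>
  have f3_id: "f3 x = x" if "x \<in> carrier_vec m" for x
    using surj12[OF that that] c12 c23 by metis
  then have f2_id: "f2 x = x" if "x \<in> carrier_vec m" for x
    using surj12[OF that that] c12 c13 that by metis
  show "B2 = B2'"
    by (rule mat_eq_by_mult_vec[OF B(2) B'(1)]) (use f2 f2_id in metis)
  show "B3 = B3'"
    by (rule mat_eq_by_mult_vec[OF B(3) B'(2)]) (use f3 f3_id in metis)
  show "C1 = C1'"
    by (rule mat_eq_by_mult_vec[OF C(1) C'(1)]) (use c12 f2_id CV(4) in metis)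
  show "C2 = C2'"
    by (rule mat_eq_by_mult_vec[OF C(2) C'(2)]) (use c12 in metis)
  show "C3 = C3'"
    by (rule mat_eq_by_mult_vec[OF C(3) C'(3)]) (use c13 in metis)
qed

text \<open>Subtracting the two equations cancels X and Y and leaves B1 (D2 - D2') = B2 (D1 - D1');
  independence makes both differences zero. X and Y stand for A_i B_j and A_j B_i, which agree in
  both extensions once the \<open>B\<close>'s do.\<close>

lemma lower_right_blocks_unique:
  fixes B1 B2 D1 D2 D1' D2' X Y :: "'a::field mat"
  assumes B: "B1 \<in> carrier_mat n m" "B2 \<in> carrier_mat n m"
    and D: "D1 \<in> carrier_mat m m" "D2 \<in> carrier_mat m m" "D1' \<in> carrier_mat m m" "D2' \<in> carrier_mat m m"
    and XY: "X \<in> carrier_mat n m" "Y \<in> carrier_mat n m"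
    and eq: "X + B1 * D2 = Y + B2 * D1" "X + B1 * D2' = Y + B2 * D1'"
    and inj: "\<forall>x\<in>carrier_vec m. \<forall>y\<in>carrier_vec m.
      B1 *\<^sub>v x + B2 *\<^sub>v y = 0\<^sub>v n \<longrightarrow> x = 0\<^sub>v m \<and> y = 0\<^sub>v m"
  shows "D1 = D1'" "D2 = D2'"
proof -
  have aux: "p - q = p' - q'" if "x + p = y + q" "x + p' = y + q'" for p q p' q' x y :: 'a
  proof -
    have "p = y + q - x" "p' = y + q' - x"
      using that by (metis add_diff_cancel_left')+
    then show ?thesis
      by simp
  qed
  have mat: "B1 * D2 - B2 * D1 = B1 * D2' - B2 * D1'"
  proof (rule eq_matI)
    fix i j assume "i < dim_row (B1 * D2' - B2 * D1')" "j < dim_col (B1 * D2' - B2 * D1')"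
    then show "(B1 * D2 - B2 * D1) $$ (i, j) = (B1 * D2' - B2 * D1') $$ (i, j)"
      using arg_cong[OF eq(1), of "\<lambda>M. M $$ (i, j)"] arg_cong[OF eq(2), of "\<lambda>M. M $$ (i, j)"] B D XY
      by (auto intro: aux simp del: index_mult_mat(1))
  qed (use B D in auto)
  have "D2 *\<^sub>v x = D2' *\<^sub>v x \<and> D1 *\<^sub>v x = D1' *\<^sub>v x" if x: "x \<in> carrier_vec m" for x
  proof -
    have "(B1 * D2 - B2 * D1) *\<^sub>v x = (B1 * D2' - B2 * D1') *\<^sub>v x"
      using mat by simp
    then have e: "B1 *\<^sub>v (D2 *\<^sub>v x) - B2 *\<^sub>v (D1 *\<^sub>v x) = B1 *\<^sub>v (D2' *\<^sub>v x) - B2 *\<^sub>v (D1' *\<^sub>v x)"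
      using B D x by (simp add: minus_mult_distrib_mat_vec[of _ n m])
    show ?thesis
      using indpt_cancel[OF B inj _ _ _ _ e] D mult_mat_vec_carrier[OF _ x] by blast
  qed
  then show "D1 = D1'" "D2 = D2'"
    using mat_eq_by_mult_vec[OF D(1,3)] mat_eq_by_mult_vec[OF D(2,4)] by blast+
qed

section \<open>Extracting the blocks and assembling the theorem\<close>

lemma commuting_extension_blocks:
  fixes A1 A2 A3 :: "'a::field mat"
  assumes "commuting_extension n r [A1, A2, A3] [Z1, Z2, Z3]"
  obtains B1 B2 B3 C1 C2 C3 D1 D2 D3 where
    "B1 \<in> carrier_mat n (r - n)" "B2 \<in> carrier_mat n (r - n)" "B3 \<in> carrier_mat n (r - n)"
    "C1 \<in> carrier_mat (r - n) n" "C2 \<in> carrier_mat (r - n) n" "C3 \<in> carrier_mat (r - n) n"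
    "D1 \<in> carrier_mat (r - n) (r - n)" "D2 \<in> carrier_mat (r - n) (r - n)"
    "D3 \<in> carrier_mat (r - n) (r - n)"
    "Z1 = four_block_mat A1 B1 C1 D1" "Z2 = four_block_mat A2 B2 C2 D2"
    "Z3 = four_block_mat A3 B3 C3 D3"
    "commutator A1 A2 = B2 * C1 - B1 * C2" "commutator A1 A3 = B3 * C1 - B1 * C3"
    "commutator A2 A3 = B3 * C2 - B2 * C3"
    "A1 * B2 + B1 * D2 = A2 * B1 + B2 * D1" "A1 * B3 + B1 * D3 = A3 * B1 + B3 * D1"
proof -
  have A: "A1 \<in> carrier_mat n n" "A2 \<in> carrier_mat n n" "A3 \<in> carrier_mat n n"
    using assms by (simp_all add: commuting_extension_def)
  have "[Z1, Z2, Z3] ! i * [Z1, Z2, Z3] ! j = [Z1, Z2, Z3] ! j * [Z1, Z2, Z3] ! i"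
    if "i < 3" "j < 3" for i j
    using assms that unfolding commuting_extension_def by simp
  from this[of 0 1] this[of 0 2] this[of 1 2]
  have comm: "Z1 * Z2 = Z2 * Z1" "Z1 * Z3 = Z3 * Z1" "Z2 * Z3 = Z3 * Z2"
    by simp_all
  have ex: "\<exists>B \<in> carrier_mat n (r - n). \<exists>C \<in> carrier_mat (r - n) n.
        \<exists>D \<in> carrier_mat (r - n) (r - n). [Z1, Z2, Z3] ! i = four_block_mat ([A1, A2, A3] ! i) B C D"
    if "i < 3" for i
    using assms that unfolding commuting_extension_def by simp
  obtain B1 C1 D1 where 1: "B1 \<in> carrier_mat n (r - n)" "C1 \<in> carrier_mat (r - n) n"
      "D1 \<in> carrier_mat (r - n) (r - n)" "Z1 = four_block_mat A1 B1 C1 D1"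
    using ex[of 0] by auto
  obtain B2 C2 D2 where 2: "B2 \<in> carrier_mat n (r - n)" "C2 \<in> carrier_mat (r - n) n"
      "D2 \<in> carrier_mat (r - n) (r - n)" "Z2 = four_block_mat A2 B2 C2 D2"
    using ex[of 1] by auto
  obtain B3 C3 D3 where 3: "B3 \<in> carrier_mat n (r - n)" "C3 \<in> carrier_mat (r - n) n"
      "D3 \<in> carrier_mat (r - n) (r - n)" "Z3 = four_block_mat A3 B3 C3 D3"
    using ex[of 2] by auto
  show ?thesis
    by (rule that[OF 1(1) 2(1) 3(1) 1(2) 2(2) 3(2) 1(3) 2(3) 3(3) 1(4) 2(4) 3(4)
          commuting_blocks(1)[OF A(1,2) 1(1) 2(1) 1(2) 2(2) 1(3) 2(3) comm(1)[unfolded 1(4) 2(4)]]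
          commuting_blocks(1)[OF A(1,3) 1(1) 3(1) 1(2) 3(2) 1(3) 3(3) comm(2)[unfolded 1(4) 3(4)]]
          commuting_blocks(1)[OF A(2,3) 2(1) 3(1) 2(2) 3(2) 2(3) 3(3) comm(3)[unfolded 2(4) 3(4)]]
          commuting_blocks(2)[OF A(1,2) 1(1) 2(1) 1(2) 2(2) 1(3) 2(3) comm(1)[unfolded 1(4) 2(4)]]
          commuting_blocks(2)[OF A(1,3) 1(1) 3(1) 1(2) 3(2) 1(3) 3(3) comm(2)[unfolded 1(4) 3(4)]]])
qed

theorem theorem2:
  fixes n r :: nat
    and A1 A2 A3 Z1 Z2 Z3 Z1' Z2' Z3' :: "'a::field mat"
  assumes "n \<le> r"
    and "A1 \<in> carrier_mat n n" and "A2 \<in> carrier_mat n n" and "A3 \<in> carrier_mat n n"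
    and "subspace_dim n (column_space (commutator A1 A2)) = 2 * (r - n)"
    and "subspace_dim n (column_space (commutator A1 A3)) = 2 * (r - n)"
    and "subspace_dim n (column_space (commutator A2 A3)) = 2 * (r - n)"
    and "subspace_dim n (subspace_plus n (column_space (commutator A1 A2))
           (column_space (commutator A1 A3))) = 3 * (r - n)"
    and "subspace_dim n (subspace_plus n (column_space (commutator A2 A1))
           (column_space (commutator A2 A3))) = 3 * (r - n)"
    and "subspace_dim n (subspace_plus n (column_space (commutator A3 A1))
           (column_space (commutator A3 A2))) = 3 * (r - n)"
    and "commuting_extension n r [A1, A2, A3] [Z1, Z2, Z3]"
    and "commuting_extension n r [A1, A2, A3] [Z1', Z2', Z3']"
    and "upper_right_block n Z1 = upper_right_block n Z1'"
  shows "(Z1, Z2, Z3) = (Z1', Z2', Z3')"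
proof -
  let ?m = "r - n"
  note A = assms(2-4)
  obtain B1 B2 B3 C1 C2 C3 D1 D2 D3 where
    B: "B1 \<in> carrier_mat n ?m" "B2 \<in> carrier_mat n ?m" "B3 \<in> carrier_mat n ?m" and
    C: "C1 \<in> carrier_mat ?m n" "C2 \<in> carrier_mat ?m n" "C3 \<in> carrier_mat ?m n" and
    D: "D1 \<in> carrier_mat ?m ?m" "D2 \<in> carrier_mat ?m ?m" "D3 \<in> carrier_mat ?m ?m" and
    Z: "Z1 = four_block_mat A1 B1 C1 D1" "Z2 = four_block_mat A2 B2 C2 D2"
      "Z3 = four_block_mat A3 B3 C3 D3" and
    com: "commutator A1 A2 = B2 * C1 - B1 * C2" "commutator A1 A3 = B3 * C1 - B1 * C3"
      "commutator A2 A3 = B3 * C2 - B2 * C3" and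
    AB: "A1 * B2 + B1 * D2 = A2 * B1 + B2 * D1" "A1 * B3 + B1 * D3 = A3 * B1 + B3 * D1"
    by (rule commuting_extension_blocks[OF assms(11)])
  obtain B1' B2' B3' C1' C2' C3' D1' D2' D3' where
    B': "B1' \<in> carrier_mat n ?m" "B2' \<in> carrier_mat n ?m" "B3' \<in> carrier_mat n ?m" and
    C': "C1' \<in> carrier_mat ?m n" "C2' \<in> carrier_mat ?m n" "C3' \<in> carrier_mat ?m n" and
    D': "D1' \<in> carrier_mat ?m ?m" "D2' \<in> carrier_mat ?m ?m" "D3' \<in> carrier_mat ?m ?m" and
    Z': "Z1' = four_block_mat A1 B1' C1' D1'" "Z2' = four_block_mat A2 B2' C2' D2'"
      "Z3' = four_block_mat A3 B3' C3' D3'" and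
    com': "commutator A1 A2 = B2' * C1' - B1' * C2'" "commutator A1 A3 = B3' * C1' - B1' * C3'"
      "commutator A2 A3 = B3' * C2' - B2' * C3'" and
    AB': "A1 * B2' + B1' * D2' = A2 * B1' + B2' * D1'" "A1 * B3' + B1' * D3' = A3 * B1' + B3' * D1'"
    by (rule commuting_extension_blocks[OF assms(12)])
  have B1: "B1' = B1"
    using assms(13) unfolding Z(1) Z'(1)
    by (simp add: upper_right_block_four_block_mat[OF A(1) B(1) C(1) D(1)]
        upper_right_block_four_block_mat[OF A(1) B'(1) C'(1) D'(1)])
  \<comment> \<open>Independence is taken for the unprimed blocks, joint surjectivity below for the
    primed ones: the former cancels coefficients, the latter produces test vectors.\<close>
  note inj = upper_right_blocks_indpt[OF B C assms(8)[unfolded com(1,2)]]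
  have surj: "\<exists>w\<in>carrier_vec n. C1' *\<^sub>v w = u \<and> C2' *\<^sub>v w = v"
      "\<exists>w\<in>carrier_vec n. C1' *\<^sub>v w = u \<and> C3' *\<^sub>v w = v"
      "\<exists>w\<in>carrier_vec n. C2' *\<^sub>v w = u \<and> C3' *\<^sub>v w = v"
    if "u \<in> carrier_vec ?m" "v \<in> carrier_vec ?m" for u v
    subgoal by (rule lower_left_blocks_jointly_surj[OF B'(1,2) C'(1,2) assms(5)[unfolded com'(1)] that]) blast
    subgoal by (rule lower_left_blocks_jointly_surj[OF B'(1,3) C'(1,3) assms(6)[unfolded com'(2)] that]) blast
    subgoal by (rule lower_left_blocks_jointly_surj[OF B'(2,3) C'(2,3) assms(7)[unfolded com'(3)] that]) blast
    done
  have e: "B2 * C1 - B1 * C2 = B2' * C1' - B1 * C2'" "B3 * C1 - B1 * C3 = B3' * C1' - B1 * C3'"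
      "B3 * C2 - B2 * C3 = B3' * C2' - B2' * C3'"
    using com'[unfolded com B1] .
  note eqs = off_diagonal_blocks_unique[OF B C B'(2,3) C' inj surj e]
  have BC: "B2' = B2" "B3' = B3" "C1' = C1" "C2' = C2" "C3' = C3"
    using eqs by blast+
  have inj12: "\<forall>x\<in>carrier_vec ?m. \<forall>y\<in>carrier_vec ?m.
      B1 *\<^sub>v x + B2 *\<^sub>v y = 0\<^sub>v n \<longrightarrow> x = 0\<^sub>v ?m \<and> y = 0\<^sub>v ?m"
  proof (intro ballI impI)
    fix x y :: "'a vec" assume "x \<in> carrier_vec ?m" "y \<in> carrier_vec ?m" "B1 *\<^sub>v x + B2 *\<^sub>v y = 0\<^sub>v n"
    then show "x = 0\<^sub>v ?m \<and> y = 0\<^sub>v ?m"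
      using inj[of x y "0\<^sub>v ?m"] mult_mat_zero_vec[OF B(3)] by simp
  qed
  have inj13: "\<forall>x\<in>carrier_vec ?m. \<forall>y\<in>carrier_vec ?m.
      B1 *\<^sub>v x + B3 *\<^sub>v y = 0\<^sub>v n \<longrightarrow> x = 0\<^sub>v ?m \<and> y = 0\<^sub>v ?m"
  proof (intro ballI impI)
    fix x y :: "'a vec" assume "x \<in> carrier_vec ?m" "y \<in> carrier_vec ?m" "B1 *\<^sub>v x + B3 *\<^sub>v y = 0\<^sub>v n"
    then show "x = 0\<^sub>v ?m \<and> y = 0\<^sub>v ?m"
      using inj[of x "0\<^sub>v ?m" y] mult_mat_zero_vec[OF B(2)] B by simp
  qed
  \<comment> \<open>The pair (1,2) settles D1 and D2; the pair (1,3) then settles D3.\<close>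
  have "D1 = D1'" "D2 = D2'"
    by (rule lower_right_blocks_unique[OF B(1,2) D(1,2) D'(1,2) _ _ AB(1) AB'(1)[unfolded B1 BC] inj12];
        use A B in simp)+
  moreover have "D3 = D3'"
    by (rule lower_right_blocks_unique(2)[OF B(1,3) D(1,3) D'(1,3) _ _ AB(2) AB'(2)[unfolded B1 BC] inj13];
        use A B in simp)
  ultimately show ?thesis
    unfolding Z Z' B1 BC by simp
qed

end
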